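(* In the $1:1$ Walker-Breaker game played on the hypercube $Q_n$, under optimal play by both players, the number of vertices visited by Walker is at least $2^{n-2}$ and at most $2^{n-1}$.
   Context: $Q_n$ is the graph with vertex set $\{0,1\}^n$ in which two strings are adjacent iff they differ in exactly one coordinate. The $1:1$ Walker-Breaker game on a graph $G$: two players, Walker and Breaker, alternate turns. Walker is positioned at a vertex of $G$ (her initial vertex counts as visited). On her turn she moves from her current vertex $v$ along any edge $e=vw$ of $G$ that has not been acquired by Breaker (revisiting vertices and reusing her own edges is allowed); if she has not already acquired $e$ she acquires it, and $w$ becomes visited. On his turn Breaker acquires one edge of $G$ not already acquired by Walker. The game ends when there is no path from Walker's current position to an unvisited vertex along edges not acquired by Breaker. Walker wants to maximize, and Breaker to minimize, the number of vertices Walker visits.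
   Formalization: The cases n = 0 and n = 1 with Walker moving first are excluded, since the upper bound fails there: Walker visits 1 > 1/2 vertices in Q_0 and 2 > 1 vertices in Q_1; the bounds are proved in all other cases, for either first player and any initial vertex. *)

theory Defs
  imports Complex_Main
begin

text \<open>An undirected graph enters only through its set of edges, each a two-element set of vertices.
  Every vertex reachable from the initial vertex is an endpoint of an edge (or the initial vertex),
  so the game does not need the vertex set separately.\<close>

datatype player = Walker | Breaker

text \<open>In the following, \<open>v\<close> is Walker's current vertex, \<open>W\<close> and \<open>B\<close> are the edges acquired so far by
  Walker and by Breaker, and \<open>S\<close> is the set of visited vertices.\<close>

definition game_over :: "'v set set \<Rightarrow> 'v \<Rightarrow> 'v set set \<Rightarrow> 'v set \<Rightarrow> bool" where
  "game_over E v B S \<longleftrightarrow> \<not> (\<exists>x. x \<notin> S \<and> (\<lambda>u w. {u, w} \<in> E - B)\<^sup>*\<^sup>* v x)"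

definition walker_moves :: "'v set set \<Rightarrow> 'v \<Rightarrow> 'v set set \<Rightarrow> 'v set" where
  "walker_moves E v B = {w. {v, w} \<in> E - B}"

text \<open>Breaker has to acquire a new edge, i.e. one that neither player owns yet.\<close>

definition breaker_moves :: "'v set set \<Rightarrow> 'v set set \<Rightarrow> 'v set set \<Rightarrow> 'v set set" where
  "breaker_moves E W B = E - (W \<union> B)"

text \<open>The number of visited vertices at the end of the game under optimal play from a given
  position, by backward induction. The recursion ends since Breaker acquires a new edge on each
  of his turns. The test for \<open>infinite E\<close> is only there to make the function total.\<close>

function position_value ::
    "'v set set \<Rightarrow> player \<Rightarrow> 'v \<Rightarrow> 'v set set \<Rightarrow> 'v set set \<Rightarrow> 'v set \<Rightarrow> nat" where
  "position_value E p v W B S =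
     (if infinite E \<or> game_over E v B S then card S
      else (case p of
        Walker \<Rightarrow>
          Max ((\<lambda>w. position_value E Breaker w (insert {v, w} W) B (insert w S))
                 ` walker_moves E v B)
      | Breaker \<Rightarrow>
          Min ((\<lambda>e. position_value E Walker v W (insert e B) S) ` breaker_moves E W B)))"
  by pat_completeness auto
termination
proof (relation "measure (\<lambda>(E, p, v, W, B, S). 2 * card (E - B) + (if p = Walker then 1 else 0))",
    goal_cases)
  case 1
  show ?case by simp
next
  case (2 E p v W B S w)
  then show ?case by simp
next
  case (3 E p v W B S e)
  then have "card (E - insert e B) < card (E - B)"
    by (intro psubset_card_mono) (auto simp: breaker_moves_def)
  with 3 show ?case by simp
qed

declare position_value.simps [simp del]

text \<open>The value of the 1:1 game on the graph with edge set \<open>E\<close> in which the player \<open>first\<close> has the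
  first turn and Walker is initially at \<open>start\<close>.\<close>

definition walker_breaker_value :: "'v set set \<Rightarrow> player \<Rightarrow> 'v \<Rightarrow> nat" where
  "walker_breaker_value E first start = position_value E first start {} {} {start}"

text \<open>The sets of moves over which \<open>Max\<close> and \<open>Min\<close> range are finite and, as long as the game is not
  over, nonempty. The hypotheses on \<open>v\<close> and \<open>W\<close> hold in every position that arises in play.\<close>

lemma finite_walker_moves:
  assumes "finite E"
  shows "finite (walker_moves E v B)"
proof -
  have "inj_on (\<lambda>w. {v, w}) (walker_moves E v B)"
    by (auto simp: inj_on_def doubleton_eq_iff)
  moreover have "(\<lambda>w. {v, w}) ` walker_moves E v B \<subseteq> E"
    by (auto simp: walker_moves_def)
  ultimately show ?thesis
    using assms by (meson finite_imageD finite_subset)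
qed

lemma finite_breaker_moves: "finite E \<Longrightarrow> finite (breaker_moves E W B)"
  by (simp add: breaker_moves_def)

lemma walker_moves_nonempty:
  assumes "\<not> game_over E v B S" "v \<in> S"
  shows "walker_moves E v B \<noteq> {}"
proof -
  obtain x where "x \<notin> S" "(\<lambda>u w. {u, w} \<in> E - B)\<^sup>*\<^sup>* v x"
    using assms(1) by (auto simp: game_over_def)
  with assms(2) show ?thesis
    by (auto simp: walker_moves_def elim: converse_rtranclpE)
qed

lemma breaker_moves_nonempty:
  assumes "\<not> game_over E v B S" "v \<in> S" "\<Union> W \<subseteq> S"
  shows "breaker_moves E W B \<noteq> {}"
proof
  assume empty: "breaker_moves E W B = {}"
  obtain x where x: "x \<notin> S" "(\<lambda>u w. {u, w} \<in> E - B)\<^sup>*\<^sup>* v x"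
    using assms(1) by (auto simp: game_over_def)
  from x(2) have "x \<in> S"
  proof (induction rule: rtranclp_induct)
    case base
    show ?case by (fact assms(2))
  next
    case (step y z)
    then have "{y, z} \<in> W" using empty by (auto simp: breaker_moves_def)
    then show ?case using assms(3) by auto
  qed
  with x(1) show False by simp
qed

definition cube_vertices :: "nat \<Rightarrow> bool list set" where
  "cube_vertices n = {x. length x = n}"

definition cube_edges :: "nat \<Rightarrow> bool list set set" where
  "cube_edges n = {{x, y} | x y. x \<in> cube_vertices n \<and> y \<in> cube_vertices n \<and>
                     card {i. i < n \<and> x ! i \<noteq> y ! i} = 1}"

lemma finite_cube_edges: "finite (cube_edges n)"
proof -
  have "finite (cube_vertices n)"
    using finite_lists_length_eq[of "UNIV :: bool set" n] by (simp add: cube_vertices_def)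
  moreover have "cube_edges n \<subseteq> Pow (cube_vertices n)"
    by (auto simp: cube_edges_def)
  ultimately show ?thesis by (meson finite_Pow_iff finite_subset)
qed

end

theory Submission
  imports Defs "HOL-Analysis.Convex"
begin

text \<open>Upper bound: Breaker fixes a direction \<open>j\<close> that Walker has not used and always answers with the
  edge in direction \<open>j\<close> at Walker's current vertex. Walker then never leaves a facet.

  Lower bound: Walker performs a depth-first search. Each vertex costs her one move to enter and at
  most one to leave, so Breaker owns fewer than \<open>2 |S|\<close> edges when she has visited the set \<open>S\<close>. When
  the game is over, Breaker owns the whole edge boundary of \<open>S\<close>, and by the edge-isoperimetric
  inequality this has at least \<open>|S| (n - log\<^sub>2 |S|)\<close> edges. Hence \<open>n - log\<^sub>2 |S| < 2\<close>.\<close>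

section \<open>Values of positions\<close>

lemma position_value_over:
  "game_over E v B S \<Longrightarrow> position_value E p v W B S = card S"
  by (subst position_value.simps) simp

text \<open>The four lemmas from here on replace \<open>Max\<close> and \<open>Min\<close>: an
  inequality for the player whose strategy is prescribed, an attained optimum for the
  opponent.\<close>

lemma position_value_Walker_ge:
  assumes "finite E" "\<not> game_over E v B S" "w \<in> walker_moves E v B"
  shows "position_value E Breaker w (insert {v, w} W) B (insert w S)
    \<le> position_value E Walker v W B S"
  by (subst (2) position_value.simps) (use assms in \<open>auto intro!: Max_ge finite_walker_moves\<close>)

lemma position_value_Walker_obtain:
  assumes "finite E" "\<not> game_over E v B S" "v \<in> S"
  obtains w where "w \<in> walker_moves E v B"
    "position_value E Walker v W B S = position_value E Breaker w (insert {v, w} W) B (insert w S)"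
proof -
  let ?f = "\<lambda>w. position_value E Breaker w (insert {v, w} W) B (insert w S)"
  have "position_value E Walker v W B S = Max (?f ` walker_moves E v B)"
    by (subst position_value.simps) (use assms in simp)
  moreover have "Max (?f ` walker_moves E v B) \<in> ?f ` walker_moves E v B"
    using assms by (intro Max_in finite_imageI finite_walker_moves) (simp_all add: walker_moves_nonempty)
  ultimately show thesis using that by auto
qed

lemma position_value_Breaker_le:
  assumes "finite E" "\<not> game_over E v B S" "e \<in> breaker_moves E W B"
  shows "position_value E Breaker v W B S \<le> position_value E Walker v W (insert e B) S"
  by (subst position_value.simps) (use assms in \<open>auto intro!: Min_le finite_breaker_moves\<close>)

lemma position_value_Breaker_obtain:
  assumes "finite E" "\<not> game_over E v B S" "v \<in> S" "\<Union> W \<subseteq> S"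
  obtains e where "e \<in> breaker_moves E W B"
    "position_value E Breaker v W B S = position_value E Walker v W (insert e B) S"
proof -
  let ?f = "\<lambda>e. position_value E Walker v W (insert e B) S"
  have "position_value E Breaker v W B S = Min (?f ` breaker_moves E W B)"
    by (subst position_value.simps) (use assms in simp)
  moreover have "Min (?f ` breaker_moves E W B) \<in> ?f ` breaker_moves E W B"
    using assms by (intro Min_in finite_imageI finite_breaker_moves) (simp_all add: breaker_moves_nonempty)
  ultimately show thesis using that by auto
qed

section \<open>Depth-first search\<close>

definition edge_boundary :: "'v set set \<Rightarrow> 'v set \<Rightarrow> 'v set set" where
  "edge_boundary E S = {{x, y} | x y. {x, y} \<in> E \<and> x \<in> S \<and> y \<notin> S}"

text \<open>\<open>T\<close> is the stack of the search, with Walker's current vertex on top; the vertices that have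
  left the stack are exhausted.\<close>

definition dfs_state ::
    "'v set \<Rightarrow> 'v set set \<Rightarrow> 'v set set \<Rightarrow> 'v set set \<Rightarrow> 'v set \<Rightarrow> 'v list \<Rightarrow> bool" where
  "dfs_state V E W B S T \<longleftrightarrow> T \<noteq> [] \<and> W \<subseteq> E \<and> W \<inter> B = {} \<and> B \<subseteq> E \<and> \<Union> W \<subseteq> S \<and> S \<subseteq> V \<and> finite S \<and>
     set T \<subseteq> S \<and> (\<forall>x\<in>S. (\<lambda>u w. {u, w} \<in> W)\<^sup>*\<^sup>* (hd T) x) \<and> successively (\<lambda>u w. {u, w} \<in> W) T \<and>
     (\<forall>x\<in>S - set T. \<forall>y. {x, y} \<in> E \<longrightarrow> y \<notin> S \<longrightarrow> {x, y} \<in> B)"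

text \<open>Walker can return to every visited vertex along her own edges, which Breaker can never
  take, so a free boundary edge would lead her to an unvisited vertex.\<close>

lemma dfs_state_game_over:
  assumes "dfs_state V E W B S T" "game_over E (hd T) B S"
  shows "edge_boundary E S \<subseteq> B"
proof (rule ccontr)
  assume "\<not> ?thesis"
  then obtain x y where xy: "{x, y} \<in> E - B" "x \<in> S" "y \<notin> S"
    by (auto simp: edge_boundary_def)
  have "(\<lambda>u w. {u, w} \<in> W)\<^sup>*\<^sup>* (hd T) x"
    using assms(1) xy(2) by (simp add: dfs_state_def)
  then have "(\<lambda>u w. {u, w} \<in> E - B)\<^sup>*\<^sup>* (hd T) x"
    by (rule rtranclp_mono[THEN predicate2D, rotated]) (use assms(1) in \<open>auto simp: dfs_state_def\<close>)
  then have "(\<lambda>u w. {u, w} \<in> E - B)\<^sup>*\<^sup>* (hd T) y"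
    using xy(1) by (rule rtranclp.rtrancl_into_rtrancl)
  with xy(3) assms(2) show False by (auto simp: game_over_def)
qed

text \<open>A path leaving \<open>S\<close> must cross its boundary. This ensures that the search
  never gets stuck before the game ends.\<close>

lemma game_over_if_boundary_subset:
  assumes "edge_boundary E S \<subseteq> B" "v \<in> S"
  shows "game_over E v B S"
proof -
  have "x \<in> S" if "(\<lambda>u w. {u, w} \<in> E - B)\<^sup>*\<^sup>* v x" for x
    using that
  proof (induction rule: rtranclp_induct)
    case base
    show ?case by (fact assms(2))
  next
    case (step y z)
    then show ?case using assms(1) by (auto simp: edge_boundary_def)
  qed
  then show ?thesis by (auto simp: game_over_def)
qed

text \<open>Connectivity survives because the new edge leads from \<open>w\<close> back to the old
  top; exhausted vertices stay exhausted since \<open>S\<close> only grows.\<close>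

lemma dfs_state_push:
  assumes "dfs_state V E W B S T" "{hd T, w} \<in> E - B" "w \<in> V"
  shows "dfs_state V E (insert {hd T, w} W) B (insert w S) (w # T)"
proof -
  let ?R = "\<lambda>u x. {u, x} \<in> insert {hd T, w} W"
  have hdS: "hd T \<in> S" using assms(1) by (auto simp: dfs_state_def)
  have "?R\<^sup>*\<^sup>* w x" if "x \<in> insert w S" for x
  proof (cases "x = w")
    case False
    then have "(\<lambda>u w. {u, w} \<in> W)\<^sup>*\<^sup>* (hd T) x" using that assms(1) by (simp add: dfs_state_def)
    then have "?R\<^sup>*\<^sup>* (hd T) x"
      by (rule rtranclp_mono[THEN predicate2D, rotated]) auto
    moreover have "?R w (hd T)" by (simp add: insert_commute)
    ultimately show ?thesis by (rule converse_rtranclp_into_rtranclp[rotated])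
  qed simp
  then have conn: "\<forall>x\<in>insert w S. ?R\<^sup>*\<^sup>* (hd (w # T)) x" by simp
  have "successively (\<lambda>u x. {u, x} \<in> W) T" using assms(1) by (simp add: dfs_state_def)
  then have "successively ?R T" by (rule successively_mono) simp
  then have path: "successively ?R (w # T)" by (simp add: successively_Cons insert_commute)
  have "insert {hd T, w} W \<subseteq> E" "insert {hd T, w} W \<inter> B = {}"
    using assms(1,2) unfolding dfs_state_def by blast+
  moreover have "\<Union> (insert {hd T, w} W) \<subseteq> insert w S"
    using assms(1) hdS unfolding dfs_state_def by blast
  moreover have "\<forall>x\<in>insert w S - set (w # T). \<forall>y. {x, y} \<in> E \<longrightarrow> y \<notin> insert w S \<longrightarrow> {x, y} \<in> B"
    using assms(1) unfolding dfs_state_def by simp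
  ultimately show ?thesis
    using assms conn path unfolding dfs_state_def by (simp add: subset_insertI2)
qed

lemma dfs_state_pop:
  assumes "dfs_state V E W B S (v # u # T)"
    and "\<And>y. {v, y} \<in> E \<Longrightarrow> y \<notin> S \<Longrightarrow> {v, y} \<in> B"
  shows "dfs_state V E W B S (u # T)"
proof -
  have e: "{u, v} \<in> W" using assms(1) by (auto simp: dfs_state_def insert_commute)
  have "(\<lambda>u w. {u, w} \<in> W)\<^sup>*\<^sup>* u x" if "x \<in> S" for x
    by (rule converse_rtranclp_into_rtranclp[of _ _ v])
      (use assms(1) that e in \<open>auto simp: dfs_state_def\<close>)
  then have conn: "\<forall>x\<in>S. (\<lambda>u w. {u, w} \<in> W)\<^sup>*\<^sup>* (hd (u # T)) x" by simp
  have "{x, y} \<in> B" if "x \<in> S - set (u # T)" "{x, y} \<in> E" "y \<notin> S" for x y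
    using assms that by (cases "x = v") (simp_all add: dfs_state_def)
  with conn show ?thesis using assms(1) by (simp add: dfs_state_def)
qed

text \<open>The counting hypothesis is a potential kept along play: a push adds 1 to
  \<open>length T\<close> and 2 to the right side, leaving 1 for the flag of Breaker's turn; a pop
  trades a stack entry for that flag; Breaker's move trades the flag for an edge.\<close>

theorem dfs_lower_bound:
  assumes "finite E" "\<Union> E \<subseteq> V"
    and iso: "\<And>S. S \<subseteq> V \<Longrightarrow> finite S \<Longrightarrow> card (edge_boundary E S) < 2 * card S \<Longrightarrow> m \<le> card S"
    and "dfs_state V E W B S T"
    and "card B + length T + (if p = Breaker then 1 else 0) \<le> 2 * card S"
  shows "m \<le> position_value E p (hd T) W B S"
  using assms
proof (induction E p "hd T" W B S arbitrary: T rule: position_value.induct)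
  case (1 E p W B S)
  note st = \<open>dfs_state V E W B S T\<close>
  note fin = \<open>finite E\<close>
  note cnt = \<open>card B + length T + (if p = Breaker then 1 else 0) \<le> 2 * card S\<close>
  have finB: "finite B" using st fin finite_subset by (auto simp: dfs_state_def)
  have T: "T \<noteq> []" "hd T \<in> S" using st by (auto simp: dfs_state_def)
  show ?case
  proof (cases "game_over E (hd T) B S")
    case True
    have "card (edge_boundary E S) \<le> card B"
      using dfs_state_game_over[OF st True] finB card_mono by blast
    \<comment> \<open>The nonempty stack makes the bound strict.\<close>
    also have "card B < 2 * card S" using cnt T(1) by (cases T) auto
    finally have "m \<le> card S" using st by (intro "1.prems"(3)) (auto simp: dfs_state_def)
    then show ?thesis using True by (simp add: position_value_over)
  next
    case not_over: False
    show ?thesis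
    proof (cases p)
      case Walker
      have *: "m \<le> position_value E Walker (hd T) W B S"
        if "w \<in> walker_moves E (hd T) B" "w = hd T'"
          "dfs_state V E (insert {hd T, w} W) B (insert w S) T'"
          "card B + length T' + 1 \<le> 2 * card (insert w S)" for w T'
      proof -
        have "m \<le> position_value E Breaker w (insert {hd T, w} W) B (insert w S)"
          using "1.hyps"(1)[OF _ Walker, of T'] "1.prems" not_over that by simp
        also have "\<dots> \<le> position_value E Walker (hd T) W B S"
          by (rule position_value_Walker_ge) (use fin not_over that in auto)
        finally show ?thesis .
      qed
      show ?thesis
      proof (cases "\<exists>w. {hd T, w} \<in> E - B \<and> w \<notin> S")
        case True
        then obtain w where w: "{hd T, w} \<in> E - B" "w \<notin> S" by blast
        have "w \<in> V" using w \<open>\<Union> E \<subseteq> V\<close> by auto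
        moreover have "finite S" using st by (simp add: dfs_state_def)
        ultimately show ?thesis
          using *[of w "w # T"] w cnt dfs_state_push[OF st w(1)] Walker
          by (simp add: walker_moves_def)
      next
        case exhausted: False
        obtain v T1 where T1: "T = v # T1" using T by (cases T) auto
        \<comment> \<open>If an exhausted root were alone on the stack, Breaker would own the whole
          boundary and the game would be over.\<close>
        have "T1 \<noteq> []"
        proof
          assume "T1 = []"
          then have "{x, y} \<in> B" if "{x, y} \<in> E" "x \<in> S" "y \<notin> S" for x y
            using st exhausted T1 that by (cases "x = v") (auto simp: dfs_state_def)
          then have "edge_boundary E S \<subseteq> B"
            by (auto simp: edge_boundary_def)
          from game_over_if_boundary_subset[OF this T(2)] not_over show False by contradiction
        qed
        then obtain u T2 where T2: "T = v # u # T2" using T1 by (cases T1) auto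
        \<comment> \<open>Backtracking reuses an edge of \<open>W\<close> and a visited vertex, so
          neither \<open>W\<close> nor \<open>S\<close> changes.\<close>
        have vu: "{v, u} \<in> W" "u \<in> S" using st T2 by (auto simp: dfs_state_def)
        then have "u \<in> walker_moves E (hd T) B"
          using st T2 by (auto simp: walker_moves_def dfs_state_def)
        moreover have "dfs_state V E W B S (u # T2)"
          using dfs_state_pop[of V E W B S v u T2] st exhausted T2 by auto
        ultimately show ?thesis
          using *[of u "u # T2"] cnt Walker T2 vu by (simp add: insert_absorb)
      qed
    next
      case Breaker
      have "\<Union> W \<subseteq> S" using st by (simp add: dfs_state_def)
      then obtain e where e: "e \<in> breaker_moves E W B"
        "position_value E Breaker (hd T) W B S = position_value E Walker (hd T) W (insert e B) S"
        using position_value_Breaker_obtain[OF fin not_over T(2)] by metis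
      have "dfs_state V E W (insert e B) S T"
        using st e(1) by (auto simp: dfs_state_def breaker_moves_def)
      moreover have "card (insert e B) = Suc (card B)"
        using e(1) finB by (simp add: breaker_moves_def)
      ultimately have "m \<le> position_value E Walker (hd T) W (insert e B) S"
        using "1.hyps"(2)[OF _ Breaker e(1), of T] "1.prems" not_over Breaker by simp
      then show ?thesis using e(2) Breaker by simp
    qed
  qed
qed

section \<open>Edge isoperimetry in the cube\<close>

text \<open>Directions \<open>i < n\<close> index the edges at a vertex. Out of range the list
  update does nothing, so \<open>flip i\<close> is an involution for every \<open>i\<close>.\<close>

definition flip :: "nat \<Rightarrow> bool list \<Rightarrow> bool list" where
  "flip i x = x[i := \<not> x ! i]"

lemma length_flip [simp]: "length (flip i x) = length x"
  by (simp add: flip_def)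

lemma flip_flip [simp]: "flip i (flip i x) = x"
  by (cases "i < length x") (simp_all add: flip_def list_update_beyond)

lemma flip_Cons_0 [simp]: "flip 0 (b # x) = (\<not> b) # x"
  by (simp add: flip_def)

lemma flip_Cons_Suc [simp]: "flip (Suc i) (b # x) = b # flip i x"
  by (simp add: flip_def)

lemma nth_flip: "i < length x \<Longrightarrow> flip i x ! j = (if i = j then \<not> x ! j else x ! j)"
  by (simp add: flip_def nth_list_update)

lemma cube_edge_iff:
  "{x, y} \<in> cube_edges n \<longleftrightarrow> x \<in> cube_vertices n \<and> (\<exists>i<n. y = flip i x)"
proof -
  have diff: "card {i. i < n \<and> x ! i \<noteq> y ! i} = 1 \<longleftrightarrow> (\<exists>i<n. y = flip i x)"
    if len: "length x = n" "length y = n" for x y :: "bool list"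
  proof
    assume "card {i. i < n \<and> x ! i \<noteq> y ! i} = 1"
    then obtain i where i: "{i. i < n \<and> x ! i \<noteq> y ! i} = {i}" by (auto simp: card_1_singleton_iff)
    then have *: "k < n \<and> x ! k \<noteq> y ! k \<longleftrightarrow> k = i" for k by (simp add: set_eq_iff)
    then have "i < n" by blast
    have "y = flip i x"
    proof (rule nth_equalityI)
      fix k assume "k < length y"
      then show "y ! k = flip i x ! k"
        using *[of k] len \<open>i < n\<close> by (cases "k = i") (simp_all add: nth_flip)
    qed (simp add: len)
    with \<open>i < n\<close> show "\<exists>i<n. y = flip i x" by blast
  next
    assume "\<exists>i<n. y = flip i x"
    then obtain i where "i < n" "y = flip i x" by blast
    then have "{i. i < n \<and> x ! i \<noteq> y ! i} = {i}" using len by (auto simp: nth_flip)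
    then show "card {i. i < n \<and> x ! i \<noteq> y ! i} = 1" by simp
  qed
  \<comment> \<open>An unordered edge may be witnessed by its endpoints in either order, hence the
    symmetry of \<open>P\<close>.\<close>
  define P where "P x y \<longleftrightarrow> x \<in> cube_vertices n \<and> y \<in> cube_vertices n \<and>
      card {i. i < n \<and> x ! i \<noteq> y ! i} = 1" for x y :: "bool list"
  have "{i. i < n \<and> x ! i \<noteq> y ! i} = {i. i < n \<and> y ! i \<noteq> x ! i}" for x y :: "bool list"
    by blast
  then have sym: "P x y" if "P y x" for x y
    using that unfolding P_def by metis
  have "cube_edges n = {{x, y} | x y. P x y}"
    by (simp only: cube_edges_def P_def)
  then have "{x, y} \<in> cube_edges n \<longleftrightarrow> P x y"
    using sym by (auto simp: doubleton_eq_iff)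
  also have "\<dots> \<longleftrightarrow> x \<in> cube_vertices n \<and> (\<exists>i<n. y = flip i x)"
    using diff[of x y] by (auto simp: P_def cube_vertices_def)
  finally show ?thesis .
qed

text \<open>With \<open>t = b / a\<close> in [0,1] this is the \<open>a\<close>-th power of 2^t
  \<le> 1 + t, the chord bound for the convex function \<open>exp\<close> between 0 and
  \<open>ln 2\<close>, multiplied by \<open>a ^ a\<close>.\<close>

lemma power_add_ge:
  fixes a b :: nat
  assumes "b \<le> a"
  shows "2 ^ b * a ^ a \<le> (a + b) ^ a"
proof (cases "a = 0")
  case False
  define t where "t = real b / real a"
  have "t \<in> {0..1}" using assms False by (simp add: t_def)
  then have "exp (t * ln 2) \<le> 1 + t"
    using convex_onD[OF exp_convex, of t 0 "ln 2"] by simp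
  then have "exp (t * ln 2) ^ a \<le> (1 + t) ^ a"
    by (rule power_mono) simp
  also have "exp (t * ln 2) ^ a = exp (real b * ln 2)"
    using False by (simp add: t_def flip: exp_of_nat_mult)
  also have "\<dots> = 2 ^ b"
    by (simp add: exp_of_nat_mult)
  finally have "2 ^ b * real a ^ a \<le> (1 + t) ^ a * real a ^ a"
    by (intro mult_right_mono) simp_all
  also have "\<dots> = (real a + real b) ^ a"
    using False by (simp add: t_def field_simps flip: power_mult_distrib)
  finally have "real (2 ^ b * a ^ a) \<le> real ((a + b) ^ a)" by simp
  then show ?thesis by (simp only: of_nat_le_iff)
qed (use assms in simp)

text \<open>In base-2 logarithms: a log a + b log b + 2b \<le> (a+b) log (a+b), the inequality that
  drives the induction on dimension. The factor \<open>(a + b) ^ b\<close> absorbs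
  \<open>(2 * b) ^ b\<close>; the rest is \<open>power_add_ge\<close>.\<close>

lemma entropy_split:
  fixes a b :: nat
  assumes "b \<le> a"
  shows "4 ^ b * (a ^ a * b ^ b) \<le> (a + b) ^ (a + b)"
proof -
  have "(4::nat) ^ b = 2 ^ b * 2 ^ b"
    by (simp flip: power_mult_distrib)
  then have "4 ^ b * (a ^ a * b ^ b) = (2 ^ b * a ^ a) * (2 * b) ^ b"
    by (simp only: power_mult_distrib ac_simps)
  also have "\<dots> \<le> (a + b) ^ a * (a + b) ^ b"
    using assms by (intro mult_mono power_add_ge power_mono) simp_all
  finally show ?thesis by (simp add: power_add)
qed

text \<open>The inequality \<open>n |S| \<le> |S| log\<^sub>2 |S| + |\<partial>S|\<close>, exponentiated; the case \<open>S = {}\<close> relies on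
  \<open>0 ^ 0 = 1\<close>.\<close>

lemma cube_edge_isoperimetry:
  assumes "S \<subseteq> cube_vertices n"
  shows "(2 ^ n) ^ card S \<le> card S ^ card S * 2 ^ (\<Sum>i<n. card {x \<in> S. flip i x \<notin> S})"
  using assms
proof (induction n arbitrary: S)
  case 0
  then have "S = {} \<or> S = {[]}" by (auto simp: cube_vertices_def)
  then show ?case by auto
next
  case (Suc n)
  define F where "F b = {x. b # x \<in> S}" for b
  define D where "D b = (\<Sum>i<n. card {x \<in> F b. flip i x \<notin> F b})" for b
  have F: "F b \<subseteq> cube_vertices n" for b using Suc.prems by (auto simp: F_def cube_vertices_def)
  have finF: "finite (F b)" for b
    using F[of b] finite_lists_length_eq[of "UNIV :: bool set" n]
    by (auto simp: cube_vertices_def intro: finite_subset)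
  have split: "card {x \<in> S. P x} = card {x \<in> F True. P (True # x)} + card {x \<in> F False. P (False # x)}"
    for P
  proof -
    have "{x \<in> S. P x} = (#) True ` {x \<in> F True. P (True # x)} \<union> (#) False ` {x \<in> F False. P (False # x)}"
    proof (intro set_eqI)
      fix x
      have "\<exists>b y. x = b # y \<or> x \<notin> S"
        using Suc.prems by (cases x) (auto simp: cube_vertices_def)
      then obtain b y where "x = b # y \<or> x \<notin> S" by blast
      then show "x \<in> {x \<in> S. P x} \<longleftrightarrow> x \<in> (#) True ` {x \<in> F True. P (True # x)} \<union>
          (#) False ` {x \<in> F False. P (False # x)}"
        by (cases b) (auto simp: F_def)
    qed
    also have "card \<dots> = card {x \<in> F True. P (True # x)} + card {x \<in> F False. P (False # x)}"
      using finF by (subst card_Un_disjoint) (auto simp: card_image)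
    finally show ?thesis .
  qed
  have cS: "card S = card (F True) + card (F False)" using split[of "\<lambda>_. True"] by simp
  \<comment> \<open>Direction 0 contributes the symmetric difference of the two halves of
    \<open>S\<close>; every other direction acts within each half.\<close>
  have bd: "(\<Sum>i<Suc n. card {x \<in> S. flip i x \<notin> S}) =
      card (F True - F False) + card (F False - F True) + D True + D False"
  proof -
    have "card {x \<in> S. flip 0 x \<notin> S} = card (F True - F False) + card (F False - F True)"
      by (subst split) (simp add: F_def set_diff_eq)
    moreover have "card {x \<in> S. flip (Suc i) x \<notin> S} =
        card {x \<in> F True. flip i x \<notin> F True} + card {x \<in> F False. flip i x \<notin> F False}" for i
      by (subst split) (simp add: F_def)
    ultimately show ?thesis
      by (simp add: sum.lessThan_Suc_shift D_def sum.distrib del: sum.lessThan_Suc)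
  qed
  \<comment> \<open>Here \<open>b\<close> is the size of the smaller half and \<open>k\<close> the
    number of boundary edges between the halves. As \<open>a \<le> b + k\<close>, the new factor
    \<open>2 ^ (a + b)\<close> is at most \<open>4 ^ b * 2 ^ k\<close>, and
    \<open>entropy_split\<close> absorbs \<open>4 ^ b\<close>.\<close>
  have step: "(2 ^ Suc n) ^ (a + b) \<le> (a + b) ^ (a + b) * 2 ^ (k + d + e)"
    if le: "b \<le> a" "a \<le> b + k" and a: "(2 ^ n) ^ a \<le> a ^ a * 2 ^ d"
      and b: "(2 ^ n) ^ b \<le> b ^ b * 2 ^ e" for a b k d e :: nat
  proof -
    have "(2 ^ Suc n) ^ (a + b) = 2 ^ (a + b) * ((2 ^ n) ^ a * (2 ^ n) ^ b :: nat)"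
      by (simp add: power_mult_distrib power_add)
    also have "\<dots> \<le> 2 ^ (2 * b + k) * ((a ^ a * 2 ^ d) * (b ^ b * 2 ^ e))"
      using le a b by (intro mult_mono power_increasing) simp_all
    also have "\<dots> = (4 ^ b * (a ^ a * b ^ b)) * 2 ^ (k + d + e)"
      by (simp add: power_add power_mult)
    also have "\<dots> \<le> (a + b) ^ (a + b) * 2 ^ (k + d + e)"
      using entropy_split[OF le(1)] by (rule mult_right_mono) simp
    finally show ?thesis .
  qed
  have IH: "(2 ^ n) ^ card (F b) \<le> card (F b) ^ card (F b) * 2 ^ D b" for b
    unfolding D_def by (rule Suc.IH) (rule F)
  have diff: "card (F b) \<le> card (F c) + (card (F b - F c) + card (F c - F b))" for b c
    using finF[of b] finF[of c] diff_card_le_card_Diff[of "F c" "F b"] by simp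
  show ?case
  proof (cases "card (F False) \<le> card (F True)")
    case True
    then show ?thesis unfolding cS bd using diff[of True False] by (intro step IH) auto
  next
    case False
    have "(2 ^ Suc n) ^ (card (F False) + card (F True)) \<le>
        (card (F False) + card (F True)) ^ (card (F False) + card (F True)) *
        2 ^ (card (F False - F True) + card (F True - F False) + D False + D True)"
      using False diff[of False True] by (intro step IH) auto
    then show ?thesis unfolding cS bd by (simp add: add.commute add.left_commute)
  qed
qed

text \<open>A boundary edge has a single endpoint in \<open>S\<close>, and its direction is the
  coordinate where its endpoints differ, so distinct pairs of direction and vertex give distinct
  edges.\<close>

lemma card_cube_boundary:
  assumes "S \<subseteq> cube_vertices n" "finite S"
  shows "(\<Sum>i<n. card {x \<in> S. flip i x \<notin> S}) \<le> card (edge_boundary (cube_edges n) S)"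
proof -
  let ?P = "Sigma {..<n} (\<lambda>i. {x \<in> S. flip i x \<notin> S})"
  let ?f = "\<lambda>(i, x). {x, flip i x}"
  have inj: "inj_on ?f ?P"
  proof (rule inj_onI, clarify)
    fix i x j y
    assume h: "i < n" "x \<in> S" "flip i x \<notin> S" "j < n" "y \<in> S" "flip j y \<notin> S"
      and eq: "{x, flip i x} = {y, flip j y}"
    then have xy: "x = y" "flip i x = flip j x" by (auto simp: doubleton_eq_iff)
    have "length x = n" using assms h by (auto simp: cube_vertices_def)
    then have "flip i x ! i \<noteq> x ! i" "j \<noteq> i \<Longrightarrow> flip j x ! i = x ! i"
      using h by (simp_all add: nth_flip)
    then have "i = j" using xy(2) by metis
    then show "i = j \<and> x = y" using xy by simp
  qed
  have sub: "?f ` ?P \<subseteq> edge_boundary (cube_edges n) S"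
  proof clarify
    fix i x
    assume "i < n" "x \<in> S" "flip i x \<notin> S"
    moreover from this have "{x, flip i x} \<in> cube_edges n"
      using assms(1) by (auto simp only: cube_edge_iff)
    ultimately show "{x, flip i x} \<in> edge_boundary (cube_edges n) S"
      unfolding edge_boundary_def by blast
  qed
  have "finite (edge_boundary (cube_edges n) S)"
    by (rule finite_subset[OF _ finite_cube_edges[of n]]) (auto simp: edge_boundary_def)
  then have "card ?P \<le> card (edge_boundary (cube_edges n) S)"
    using card_inj_on_le[OF inj sub] by simp
  then show ?thesis using assms(2) by simp
qed

text \<open>With \<open>s = card S\<close>, isoperimetry gives (2^n)^s \<le> s^s 4^s = (4s)^s. The
  strict bound on the boundary makes s positive, so s-th roots may be taken.\<close>

lemma cube_small_boundary:
  assumes "S \<subseteq> cube_vertices n" "finite S"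
    and "card (edge_boundary (cube_edges n) S) < 2 * card S"
  shows "2 ^ n \<le> 4 * card S"
proof -
  let ?s = "card S"
  have "(2 ^ n) ^ ?s \<le> ?s ^ ?s * 2 ^ (\<Sum>i<n. card {x \<in> S. flip i x \<notin> S})"
    by (rule cube_edge_isoperimetry) fact
  also have "\<dots> \<le> ?s ^ ?s * 2 ^ (2 * ?s)"
    using card_cube_boundary[OF assms(1,2)] assms(3) by (intro mult_left_mono power_increasing) auto
  also have "\<dots> = (4 * ?s) ^ ?s"
    by (simp add: power_mult power_mult_distrib)
  finally have "(2 ^ n) ^ ?s \<le> (4 * ?s) ^ ?s" .
  moreover have "0 < ?s" using assms(3) by simp
  ultimately show ?thesis by (simp only: power_mono_iff zero_le)
qed

section \<open>The lower bound for the cube\<close>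

lemma cube_value_ge:
  assumes "start \<in> cube_vertices n"
  shows "2 ^ n \<le> 4 * walker_breaker_value (cube_edges n) first start"
proof -
  have V: "\<Union> (cube_edges n) \<subseteq> cube_vertices n" by (auto simp: cube_edges_def)
  \<comment> \<open>This is \<open>2 ^ n\<close> divided by 4 and rounded up: a natural number is
    required, and 4 does not divide \<open>2 ^ n\<close> for \<open>n < 2\<close>.\<close>
  have "(2 ^ n + 3) div 4 \<le> position_value (cube_edges n) first (hd [start]) {} {} {start}"
  proof (rule dfs_lower_bound[OF finite_cube_edges V])
    show "(2 ^ n + 3) div 4 \<le> card S"
      if "S \<subseteq> cube_vertices n" "finite S" "card (edge_boundary (cube_edges n) S) < 2 * card S" for S
      using cube_small_boundary[OF that] by linarith
    show "dfs_state (cube_vertices n) (cube_edges n) {} {} {start} [start]"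
      using assms by (simp add: dfs_state_def)
  \<comment> \<open>The initial count is 1, or 2 if Breaker begins, and so at most
    \<open>2 * card {start}\<close>.\<close>
  qed simp
  then show ?thesis unfolding walker_breaker_value_def list.sel by linarith
qed

section \<open>Confining Walker to a facet\<close>

text \<open>\<open>flip j\<close> matches the two opposite facets, so each is half of the
  cube.\<close>

lemma card_facet:
  assumes "j < n"
  shows "card {x \<in> cube_vertices n. x ! j = c} = 2 ^ (n - 1)"
proof -
  let ?H = "\<lambda>c. {x \<in> cube_vertices n. x ! j = c}"
  have fin: "finite (cube_vertices n)" and card: "card (cube_vertices n) = 2 ^ n"
    using finite_lists_length_eq[of "UNIV :: bool set" n] card_lists_length_eq[of "UNIV :: bool set" n]
    by (simp_all add: cube_vertices_def)
  have "bij_betw (flip j) (?H c) (?H (\<not> c))"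
    by (rule bij_betwI[where g = "flip j"]) (use assms in \<open>auto simp: cube_vertices_def nth_flip\<close>)
  then have "card (?H c) = card (?H (\<not> c))" by (rule bij_betw_same_card)
  moreover have "card (?H c \<union> ?H (\<not> c)) = card (?H c) + card (?H (\<not> c))"
    using fin by (intro card_Un_disjoint) auto
  moreover have "?H c \<union> ?H (\<not> c) = cube_vertices n" by auto
  moreover have "(2::nat) ^ n = 2 * 2 ^ (n - 1)" using assms by (cases n) auto
  ultimately show ?thesis using card by simp
qed

text \<open>Invariant of Breaker's strategy: the visited set lies in the facet \<open>H\<close>, and
  on Walker's turn he owns the only edge from \<open>v\<close> out of \<open>H\<close>.\<close>

lemma facet_upper_bound:
  fixes n j c
  defines "H \<equiv> {x \<in> cube_vertices n. x ! j = c}"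
  assumes "j < n" "v \<in> S" "S \<subseteq> H" "\<Union> W \<subseteq> S"
    and "p = Walker \<Longrightarrow> {v, flip j v} \<in> B"
  shows "position_value (cube_edges n) p v W B S \<le> 2 ^ (n - 1)"
  using assms(3-)
proof (induction "cube_edges n" p v W B S rule: position_value.induct)
  case (1 p v W B S)
  let ?E = "cube_edges n"
  have vH: "v \<in> H" using "1.prems" by auto
  have flip_notin: "flip j x \<notin> H" if "x \<in> H" for x
    using that assms(2) by (auto simp: H_def cube_vertices_def nth_flip)
  show ?case
  proof (cases "game_over ?E v B S")
    case True
    have "finite H"
      using card_facet[OF assms(2), of c] by (intro card_ge_0_finite) (simp add: H_def)
    then have "card S \<le> card H" using "1.prems" by (intro card_mono)
    then show ?thesis using True card_facet[OF assms(2), of c]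
      by (simp add: position_value_over H_def)
  next
    case not_over: False
    show ?thesis
    proof (cases p)
      case Walker
      obtain w where w: "w \<in> walker_moves ?E v B"
        "position_value ?E Walker v W B S =
          position_value ?E Breaker w (insert {v, w} W) B (insert w S)"
        using position_value_Walker_obtain[OF finite_cube_edges not_over \<open>v \<in> S\<close>] by metis
      obtain i where i: "i < n" "w = flip i v"
        using w(1) by (auto simp: walker_moves_def cube_edge_iff)
      have "i \<noteq> j" using "1.prems"(4)[OF Walker] w(1) i by (auto simp: walker_moves_def)
      then have "w \<in> H" using vH i by (simp add: H_def cube_vertices_def nth_flip)
      then have "position_value ?E Breaker w (insert {v, w} W) B (insert w S) \<le> 2 ^ (n - 1)"
        using "1.prems" w(1) not_over
        by (intro "1.hyps"(1)) (auto simp: Walker finite_cube_edges)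
      then show ?thesis using w(2) Walker by simp
    next
      case Breaker
      \<comment> \<open>If the edge at \<open>v\<close> in direction \<open>j\<close> is already
        Breaker's, any free edge serves as his compulsory move. Otherwise it is still free: its
        other end is outside \<open>H\<close>, hence unvisited, whereas Walker's edges join visited
        vertices.\<close>
      obtain e where e: "e \<in> breaker_moves ?E W B" "{v, flip j v} \<in> insert e B"
      proof (cases "{v, flip j v} \<in> B")
        case True
        then show thesis
          using that breaker_moves_nonempty[OF not_over] "1.prems" by blast
      next
        case False
        have "flip j v \<notin> S" using flip_notin[OF vH] "1.prems" by auto
        then have "{v, flip j v} \<notin> W" using "1.prems" by auto
        moreover have "{v, flip j v} \<in> ?E" using vH assms(2) by (auto simp: cube_edge_iff H_def)
        ultimately show thesis using that[of "{v, flip j v}"] False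
          by (simp add: breaker_moves_def)
      qed
      have "position_value ?E Walker v W (insert e B) S \<le> 2 ^ (n - 1)"
        using "1.prems" e not_over
        by (intro "1.hyps"(2)) (auto simp: Breaker finite_cube_edges)
      then show ?thesis
        using position_value_Breaker_le[OF finite_cube_edges not_over e(1)] Breaker
        by (meson order_trans)
    qed
  qed
qed

text \<open>For \<open>n = 1\<close> Walker moving first crosses the only edge at once and visits 2
  vertices, whence the second assumption.\<close>

lemma cube_value_le:
  assumes "n \<ge> 1" "n = 1 \<Longrightarrow> first = Breaker" "start \<in> cube_vertices n"
  shows "walker_breaker_value (cube_edges n) first start \<le> 2 ^ (n - 1)"
proof (cases first)
  case Breaker
  then show ?thesis
    unfolding walker_breaker_value_def using assms
    by (intro facet_upper_bound[where j = 0 and c = "start ! 0"]) auto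
next
  case Walker
  then have "n \<ge> 2" using assms(1,2) by (cases "n = 1") auto
  let ?E = "cube_edges n"
  show ?thesis
  proof (cases "game_over ?E start {} {start}")
    case True
    then show ?thesis by (simp add: walker_breaker_value_def position_value_over)
  next
    case False
    obtain w where w: "w \<in> walker_moves ?E start {}"
      "position_value ?E Walker start {} {} {start} =
        position_value ?E Breaker w {{start, w}} {} {w, start}"
      using position_value_Walker_obtain[OF finite_cube_edges False] by (metis singletonI)
    obtain i where i: "i < n" "w = flip i start"
      using w(1) by (auto simp: walker_moves_def cube_edge_iff)
    \<comment> \<open>Walker's opening move meets no Breaker edge, so the direction to block is
      chosen only afterwards, different from \<open>i\<close>; this takes
      \<open>n \<ge> 2\<close>.\<close>
    define j where "j = (if i = 0 then 1 else 0 :: nat)"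
    have j: "j < n" "i \<noteq> j" using \<open>n \<ge> 2\<close> by (auto simp: j_def)
    have "position_value ?E Breaker w {{start, w}} {} {w, start} \<le> 2 ^ (n - 1)"
      using assms(3) i j
      by (intro facet_upper_bound[where j = j and c = "start ! j"])
        (auto simp: cube_vertices_def nth_flip)
    then show ?thesis using w(2) Walker by (simp add: walker_breaker_value_def)
  qed
qed

section \<open>Combination of the two bounds\<close>

theorem theorem4:
  fixes n :: nat and first :: player and start :: "bool list"
  assumes "n \<ge> 1"
    and "n = 1 \<Longrightarrow> first = Breaker"
    and "start \<in> cube_vertices n"
  shows "2 powi (int n - 2) \<le> real (walker_breaker_value (cube_edges n) first start) \<and>
         real (walker_breaker_value (cube_edges n) first start) \<le> 2 powi (int n - 1)"
proof
  let ?x = "walker_breaker_value (cube_edges n) first start"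
  have "real (2 ^ n) \<le> real (4 * ?x)"
    using cube_value_ge[OF assms(3)] by (simp only: of_nat_le_iff)
  \<comment> \<open>The integer exponent matters for \<open>n = 1\<close>, where the bound is
    1/2.\<close>
  then show "2 powi (int n - 2) \<le> real ?x"
    by (simp add: power_int_diff)
  have "real ?x \<le> real (2 ^ (n - 1))"
    using cube_value_le[OF assms] by (simp only: of_nat_le_iff)
  also have "real (2 ^ (n - 1)) = 2 powi (int n - 1)"
    using assms(1) by (cases n) (simp_all add: power_int_diff)
  finally show "real ?x \<le> 2 powi (int n - 1)" .
qed

end
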